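(* Let $\alpha_1,\ldots,\alpha_n>0$, let $\alpha=\sum_{i=1}^n\alpha_i$, and let $x_1,\ldots,x_n\in(0,1)$. Let $E\subseteq\{1,\ldots,n\}$ be any subset such that the weighted reflection mean $M_E(\vec x)$ satisfies $0<M_E(\vec x)<1$. Then $$\prod_{i=1}^{n}\sin^{\alpha_i}(\pi x_i)\;\leq\;\sin^{\alpha}\bigl(\pi M_E(\vec x)\bigr).$$
   Context: For a subset $E\subseteq\{1,\ldots,n\}$ (called a reflection set), put $a_i=x_i$ if $i\notin E$ and $a_i=1-x_i$ if $i\in E$. The weighted reflection mean is $$M_E(\vec x)=\frac1\alpha\sum_{i=1}^n\alpha_i a_i=\frac{\sum_{i=1}^{n}\alpha_i x_i-\sum_{i\in E}\alpha_i(2x_i-1)}{\alpha},\qquad \alpha=\sum_{i=1}^n\alpha_i .$$ Here $\sin^{c}(t)$ denotes $(\sin t)^c$. *)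

theory Defs
  imports Complex_Main
begin

definition reflect :: "nat set \<Rightarrow> (nat \<Rightarrow> real) \<Rightarrow> nat \<Rightarrow> real" where
  "reflect E x i = (if i \<in> E then 1 - x i else x i)"

definition weighted_reflection_mean ::
    "nat \<Rightarrow> (nat \<Rightarrow> real) \<Rightarrow> nat set \<Rightarrow> (nat \<Rightarrow> real) \<Rightarrow> real" where
  "weighted_reflection_mean n \<alpha> E x =
     (\<Sum>i=1..n. \<alpha> i * reflect E x i) / (\<Sum>i=1..n. \<alpha> i)"

lemma weighted_reflection_mean_alt:
  assumes "E \<subseteq> {1..n}"
  shows "weighted_reflection_mean n \<alpha> E x =
    ((\<Sum>i=1..n. \<alpha> i * x i) - (\<Sum>i\<in>E. \<alpha> i * (2 * x i - 1))) / (\<Sum>i=1..n. \<alpha> i)"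
proof -
  have "(\<Sum>i\<in>E. \<alpha> i * (2 * x i - 1)) =
      (\<Sum>i=1..n. if i \<in> E then \<alpha> i * (2 * x i - 1) else 0)"
    using assms by (simp add: sum.If_cases Int_absorb1)
  moreover have "(\<Sum>i=1..n. \<alpha> i * reflect E x i) =
      (\<Sum>i=1..n. \<alpha> i * x i - (if i \<in> E then \<alpha> i * (2 * x i - 1) else 0))"
    by (rule sum.cong) (auto simp: reflect_def algebra_simps)
  ultimately show ?thesis
    by (simp add: weighted_reflection_mean_def sum_subtractf)
qed

end

theory Submission
  imports Defs "HOL-Analysis.Convex"
begin

text \<open>
  Since sin (pi (1 - t)) = sin (pi t), the reflections do not change the left-hand side, so after
  taking logarithms the claim is Jensen's inequality for the concave function ln (sin (pi t)).
\<close>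

lemma sin_pi_gt_zero:
  fixes x :: real
  assumes "x \<in> {0<..<1}"
  shows "sin (pi * x) > 0"
  using assms by (intro sin_gt_zero) auto

text \<open>The first derivative is \<open>pi * cot (pi * x)\<close>, and the second is
  \<open>- (pi / sin (pi * x))^2\<close>, which is never positive.\<close>

lemma concave_on_ln_sin_pi: "concave_on {0<..<1} (\<lambda>x::real. ln (sin (pi * x)))"
proof (rule f''_le0_imp_concave)
  fix x :: real assume "x \<in> {0<..<1}"
  then have pos: "sin (pi * x) > 0" by (rule sin_pi_gt_zero)
  show "((\<lambda>x. ln (sin (pi * x))) has_real_derivative pi * cot (pi * x)) (at x)"
    using pos by (auto intro!: derivative_eq_intros simp: cot_def field_simps)
  have "((\<lambda>x. cot (pi * x)) has_real_derivative - inverse ((sin (pi * x))\<^sup>2) * pi) (at x)"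
    using pos by (intro DERIV_chain2[OF DERIV_cot]) (auto intro!: derivative_eq_intros)
  then show "((\<lambda>x. pi * cot (pi * x)) has_real_derivative
      pi * (- inverse ((sin (pi * x))\<^sup>2) * pi)) (at x)"
    by (rule DERIV_cmult)
qed (auto simp: mult_le_0_iff)

lemma sin_pi_reflect: "sin (pi * reflect E x i) = sin (pi * x i)"
  by (simp add: reflect_def right_diff_distrib)

theorem theorem3p1:
  fixes n :: nat and \<alpha> x :: "nat \<Rightarrow> real" and E :: "nat set"
  assumes "\<And>i. i \<in> {1..n} \<Longrightarrow> \<alpha> i > 0"
    and "\<And>i. i \<in> {1..n} \<Longrightarrow> x i \<in> {0<..<1}"
    and "E \<subseteq> {1..n}"
    and "0 < weighted_reflection_mean n \<alpha> E x"
    and "weighted_reflection_mean n \<alpha> E x < 1"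
  shows "(\<Prod>i=1..n. sin (pi * x i) powr \<alpha> i)
    \<le> sin (pi * weighted_reflection_mean n \<alpha> E x) powr (\<Sum>i=1..n. \<alpha> i)"
proof -
  define A where "A = (\<Sum>i=1..n. \<alpha> i)"
  let ?M = "weighted_reflection_mean n \<alpha> E x"
  \<comment> \<open>For n = 0 the numerator of the mean is an empty sum, so the mean would be 0,
    against its assumed positivity.\<close>
  have ne: "{1..n} \<noteq> {}"
    using assms(4) unfolding weighted_reflection_mean_def by (metis div_0 less_irrefl sum.empty)
  then have A: "A > 0"
    unfolding A_def using assms(1) by (intro sum_pos) auto
  have sin_x: "sin (pi * x i) > 0" if "i \<in> {1..n}" for i
    using assms(2)[OF that] by (rule sin_pi_gt_zero)
  \<comment> \<open>Jensen with weights \<open>\<alpha> i / A\<close> at the reflected points, which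
    stay in (0,1).\<close>
  have "(\<Sum>i=1..n. \<alpha> i / A * ln (sin (pi * reflect E x i)))
      \<le> ln (sin (pi * (\<Sum>i=1..n. (\<alpha> i / A) *\<^sub>R reflect E x i)))"
  proof (rule concave_on_sum[OF _ ne concave_on_ln_sin_pi])
    show "(\<Sum>i=1..n. \<alpha> i / A) = 1"
      using A by (simp add: A_def flip: sum_divide_distrib)
    show "\<alpha> i / A \<ge> 0" if "i \<in> {1..n}" for i
      using assms(1)[OF that] A by simp
    show "reflect E x i \<in> {0<..<1}" if "i \<in> {1..n}" for i
      using assms(2)[OF that] by (auto simp: reflect_def)
  qed simp
  also have "(\<Sum>i=1..n. (\<alpha> i / A) *\<^sub>R reflect E x i) = ?M"
    by (simp add: weighted_reflection_mean_def A_def sum_divide_distrib)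
  \<comment> \<open>The reflections vanish on the left, where each point sits under its own sine; on
    the right they survive inside the mean.\<close>
  finally have "(\<Sum>i=1..n. \<alpha> i * ln (sin (pi * x i))) / A \<le> ln (sin (pi * ?M))"
    by (simp add: sin_pi_reflect sum_divide_distrib)
  then have jensen: "(\<Sum>i=1..n. \<alpha> i * ln (sin (pi * x i))) \<le> A * ln (sin (pi * ?M))"
    using A by (simp add: field_simps)
  \<comment> \<open>As each sine is positive, each \<open>powr\<close> factor is the exponential of
    \<open>\<alpha> i\<close> times a logarithm, and the product becomes the exponential of the
    sum.\<close>
  have "(\<Prod>i=1..n. sin (pi * x i) powr \<alpha> i) = exp (\<Sum>i=1..n. \<alpha> i * ln (sin (pi * x i)))"
    unfolding exp_sum[OF finite_atLeastAtMost]
    using sin_x by (intro prod.cong refl) (force simp: powr_def)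
  also have "\<dots> \<le> exp (A * ln (sin (pi * ?M)))"
    using jensen by simp
  \<comment> \<open>Both bounds on the mean enter here: they make the sine positive, which avoids
    the special value 0 of \<open>powr\<close> at base 0.\<close>
  also have "\<dots> = sin (pi * ?M) powr A"
    using sin_pi_gt_zero[of ?M] assms(4,5) by (simp add: powr_def)
  finally show ?thesis
    by (simp add: A_def)
qed

end
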